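(* Let $d\ge1$, let $\alpha,\beta$ be complex numbers with $w=\alpha-\beta\neq0$, let $b_0,\dots,b_{d-2}$ be complex numbers, and set $b_k=0$ for $k\ge d-1$. Let $\{P_n\}_{n\ge0}$ be the polynomials defined by $$\sum_{n\ge0}P_n(x)\frac{t^n}{n!}=\left(\frac{1-\beta t}{1-\alpha t}\right)^{x/w}A(t),\qquad A(0)=1,\qquad \frac{A'(t)}{A(t)}=\sum_{k\ge0}b_k\frac{t^k}{k!},$$ and let $Q_n=(n+1)^{-1}\Delta_wP_{n+1}$, so that $P_n=Q_n-n\alpha Q_{n-1}$. Assume that $\{P_n\}$ and $\{Q_n\}$ are $d$-orthogonal polynomial sequences. Then, for all $n\ge0$ (with $P_m=Q_m=0$ for $m<0$), the following hold: \begin{align*} &P_n(x+w)=Q_n(x)-n\beta Q_{n-1}(x),\\ &P_n(x)-\beta nP_{n-1}(x)=P_n(x+w)-\alpha nP_{n-1}(x+w),\\ &wQ_n(x)=\alpha P_n(x+w)-\beta P_n(x),\\ &\Delta_w\{P_{n+1}(x)P_n(x)\}=(n+1)P_n(x+w)Q_n(x)+nP_{n+1}(x)Q_{n-1}(x)\\ &\qquad=(n+1)Q_n^2(x)+nP_{n+1}(x)Q_{n-1}(x)-n(n+1)\beta Q_n(x)Q_{n-1}(x),\\ &(x-c)Q_n(x)=P_{n+1}(x)-(c+b_0+\beta n)P_n(x)+\sum_{i=1}^{d-1}\binom{n}{i}\left(\beta i\,b_{i-1}-b_i\right)P_{n-i}(x), \end{align*} where $c$ is the constant, independent of $m$, such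 that $$\beta_m=c-\lambda_m-\sum_{j=0}^{d-1}\frac{\eta_{m-j}^{d-1-j}}{\lambda_m\lambda_{m-1}\cdots\lambda_{m-j}}\quad (m\ge d),\qquad \lambda_m=m\alpha,$$ with $\beta_m$ and $\eta_m^k$ the recurrence coefficients of $\{P_n\}$ and $\{Q_n\}$ described in the context.
   Context: $\Delta_wf(x)=\dfrac{f(x+w)-f(x)}{w}$. Generating functions are formal power series in $t$. A sequence of monic polynomials $\{P_n\}_{n\ge0}$ with $\deg P_n=n$ is a $d$-orthogonal polynomial sequence if there are linear functionals $u_0,\dots,u_{d-1}$ on polynomials such that, for each $0\le r\le d-1$ and all $m\ge0$: $\langle u_r,x^mP_n\rangle=0$ for $n\ge md+r+1$, and $\langle u_r,x^mP_{md+r}\rangle\ne0$. Equivalently (known), $P_0=1$ and $$P_{n+1}(x)=(x-\beta_n)P_n(x)-\sum_{\nu=0}^{d-1}\gamma_{n-\nu}^{d-1-\nu}P_{n-1-\nu}(x),\qquad n\ge0,$$ with $P_m=0$ for $m<0$ and $\gamma_m^0\neq0$ for $m\ge1$ (superscripts are indices; the recurrence coefficients $\beta_n$ are not to be confused with the parameter $\beta$). Similarly, $$Q_{n+1}(x)=(x-\xi_n)Q_n(x)-\sum_{\nu=0}^{d-1}\eta_{n-\nu}^{d-1-\nu}Q_{n-1-\nu}(x),\qquad n\ge0.$$ Under the stated hypotheses $\alpha\ne0$, and the quantity $\beta_m+\lambda_m+\sum_{j=0}^{d-1}\eta_{m-j}^{d-1-j}/(\lambda_m\cdots\lambda_{m-j})$,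 $m\ge d$, is known not to depend on $m$; its value is $c$. *)

theory Defs
  imports Complex_Main "HOL-Computational_Algebra.Computational_Algebra"
begin

definition Delta :: "complex \<Rightarrow> (complex \<Rightarrow> complex) \<Rightarrow> complex \<Rightarrow> complex" where
  "Delta w f x = (f (x + w) - f x) / w"

(* The power f^a of a formal power series f with constant term 1, i.e. the
   binomial series (1 + t)^a composed with f - 1. *)
definition fps_cpow :: "complex fps \<Rightarrow> complex \<Rightarrow> complex fps" where
  "fps_cpow f a = fps_binomial a oo (f - 1)"

(* Extension of a sequence to integer indices by 0 at negative indices. *)
definition ext0 :: "(nat \<Rightarrow> complex poly) \<Rightarrow> int \<Rightarrow> complex poly" where
  "ext0 P k = (if k < 0 then 0 else P (nat k))"

definition monic_seq :: "(nat \<Rightarrow> complex poly) \<Rightarrow> bool" where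
  "monic_seq P \<longleftrightarrow> (\<forall>n. degree (P n) = n \<and> lead_coeff (P n) = 1)"

definition d_orthogonal :: "nat \<Rightarrow> (nat \<Rightarrow> complex poly) \<Rightarrow> bool" where
  "d_orthogonal d P \<longleftrightarrow> monic_seq P \<and>
     (\<exists>u :: nat \<Rightarrow> complex poly \<Rightarrow> complex.
        \<forall>r<d. Vector_Spaces.linear smult (*) (u r) \<and>
          (\<forall>m n. n \<ge> m * d + r + 1 \<longrightarrow> u r (monom 1 m * P n) = 0) \<and>
          (\<forall>m. u r (monom 1 m * P (m * d + r)) \<noteq> 0))"

(* be and ga are the recurrence coefficients of P; ga k m has upper index k and
   lower index m. For n \<le> \<nu> the truncated lower index n - \<nu> is irrelevant, since
   the polynomial it multiplies has negative index. For a d-orthogonal sequence,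
   such coefficients exist, they are unique on the indices 0 \<le> k < d, m \<ge> 1 that
   occur, and they satisfy ga 0 m \<noteq> 0 for m \<ge> 1. *)
definition recurrence_coeffs ::
    "nat \<Rightarrow> (nat \<Rightarrow> complex poly) \<Rightarrow> (nat \<Rightarrow> complex) \<Rightarrow> (nat \<Rightarrow> nat \<Rightarrow> complex) \<Rightarrow> bool" where
  "recurrence_coeffs d P be ga \<longleftrightarrow>
     (\<forall>n. P (n + 1) = [:- be n, 1:] * P n
        - (\<Sum>\<nu><d. smult (ga (d - 1 - \<nu>) (n - \<nu>)) (ext0 P (int n - 1 - int \<nu>))))"

end

theory Submission
  imports Defs
begin

text \<open>
  Let \<open>G(x,t)\<close> and \<open>H(x,t)\<close> be the exponential generating functions of \<open>P\<close> and \<open>Q\<close>, and let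
  \<open>B = A'/A\<close>. Raising the exponent \<open>x/w\<close> by one multiplies the power by its base, so
  \<open>(1 - \<alpha>t) G(x+w,t) = (1 - \<beta>t) G(x,t)\<close>. Taking the difference quotient and using
  \<open>w = \<alpha> - \<beta>\<close> gives \<open>(1 - \<alpha>t) H = G\<close>, hence \<open>(1 - \<beta>t) H(x,t) = G(x+w,t)\<close>. The coefficients of
  these three equations give the first three identities; the two formulas for the difference of
  \<open>P\<^bsub>n+1\<^esub> P\<^sub>n\<close> are then the product rule for differences.

  For the last identity, the logarithmic derivative of \<open>(1 - \<beta>t)/(1 - \<alpha>t)\<close> is
  \<open>w/((1 - \<alpha>t)(1 - \<beta>t))\<close>. Therefore \<open>x H = (1 - \<beta>t) (G' - B G)\<close>, the prime denoting the
  derivative in \<open>t\<close>, and comparing coefficients expands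
  \<open>x Q\<^sub>n\<close> in \<open>P\<^bsub>n+1\<^esub>, \<dots>, P\<^bsub>n-d+1\<^esub>\<close> (lemma \<open>x_mult_Q\<close>). This is the last identity with \<open>c = 0\<close>,
  so what remains is that the constant attached to the recurrences is indeed 0.

  Let \<open>L\<close> be the functional \<open>u\<^sub>0\<close> of the orthogonality of \<open>P\<close>; it kills every \<open>P\<^sub>n\<close> with
  \<open>n \<ge> 1\<close>. From \<open>P\<^sub>n = Q\<^sub>n - \<lambda>\<^sub>n Q\<^bsub>n-1\<^esub>\<close> it follows that
  \<open>L(Q\<^sub>n) = \<lambda>\<^sub>n L(Q\<^bsub>n-1\<^esub>)\<close>, so the products of \<open>\<lambda>\<close> in the definition of the constant are
  quotients of values of \<open>L\<close>. Applying \<open>L\<close> to the recurrence of \<open>Q\<close> identifies the constant with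
  \<open>L(x Q\<^sub>m)/L(Q\<^sub>m)\<close> (lemma \<open>recurrence_constant_as_ratio\<close>), and the expansion of \<open>x Q\<^sub>m\<close>
  contains no \<open>P\<^sub>0\<close> when \<open>m \<ge> d\<close>, so the numerator vanishes.
\<close>

section \<open>Exponential generating functions\<close>

definition egf :: "(nat \<Rightarrow> complex) \<Rightarrow> complex fps" where
  "egf a = Abs_fps (\<lambda>n. a n / fact n)"

lemma egf_nth [simp]: "fps_nth (egf a) n = a n / fact n"
  by (simp add: egf_def)

lemma egf_eq_iff: "egf a = egf a' \<longleftrightarrow> (\<forall>n. a n = a' n)"
  by (auto simp: fps_eq_iff)

lemma egf_diff: "egf a - egf a' = egf (\<lambda>n. a n - a' n)"
  by (simp add: fps_eq_iff diff_divide_distrib)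

lemma egf_scale: "fps_const c * egf a = egf (\<lambda>n. c * a n)"
  by (simp add: fps_eq_iff)

lemma egf_deriv: "fps_deriv (egf a) = egf (\<lambda>n. a (Suc n))"
  by (simp add: fps_eq_iff field_simps del: of_nat_Suc)

lemma egf_mult:
  "egf a * egf a' = egf (\<lambda>n. \<Sum>i\<le>n. of_nat (n choose i) * a i * a' (n - i))"
  by (auto simp: fps_eq_iff fps_mult_nth sum_divide_distrib binomial_fact atLeast0AtMost
      intro!: sum.cong)

lemma egf_X_mult: "fps_X * egf a = egf (\<lambda>n. of_nat n * a (n - 1))"
proof (rule fps_ext)
  fix n show "fps_nth (fps_X * egf a) n = fps_nth (egf (\<lambda>n. of_nat n * a (n - 1))) n"
    by (cases n) (simp_all add: field_simps del: of_nat_Suc)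
qed

text \<open>
  At \<open>n = 0\<close> the truncated index \<open>n - 1\<close> is harmless because of the factor \<open>n\<close>; the same device
  replaces the convention of vanishing members at negative indices below.
\<close>
lemma egf_linear_mult:
  "(1 - fps_const c * fps_X) * egf a = egf (\<lambda>n. a n - of_nat n * c * a (n - 1))"
proof -
  have "(1 - fps_const c * fps_X) * egf a = egf a - fps_const c * (fps_X * egf a)"
    by (simp add: algebra_simps)
  then show ?thesis
    by (simp add: egf_X_mult egf_scale egf_diff mult_ac)
qed

section \<open>Complex powers of formal power series\<close>

lemma fps_cpow_add_one:
  assumes "fps_nth F 0 = 1"
  shows "fps_cpow F (a + 1) = F * fps_cpow F a"
  using assms
  by (simp add: fps_cpow_def fps_binomial_add_mult fps_binomial_1 fps_compose_mult_distrib
      fps_compose_add_distrib)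

lemma fps_cpow_nth_0: "fps_nth (fps_cpow F a) 0 = 1"
  by (simp add: fps_cpow_def)

text \<open>
  The chain rule \<open>(F\<^sup>a)' = a F' F\<^bsup>a-1\<^esup>\<close>, multiplied by \<open>F\<close> so that the exponent stays \<open>a\<close>.
  It comes from the differential equation \<open>(1 + t) \<phi>' = a \<phi>\<close> of the binomial series, by
  substituting \<open>F - 1\<close> for \<open>t\<close>.
\<close>
lemma fps_deriv_cpow:
  assumes F0: "fps_nth F 0 = 1"
  shows "F * fps_deriv (fps_cpow F a) = fps_const a * fps_deriv F * fps_cpow F a"
proof -
  have d: "(1 + fps_X) * fps_deriv (fps_binomial a) = fps_const a * fps_binomial a"
    by (subst fps_binomial_deriv, subst fps_divide_unit) (simp_all add: field_simps inverse_mult_eq_1')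
  have "((1 + fps_X) * fps_deriv (fps_binomial a)) oo (F - 1) = F * (fps_deriv (fps_binomial a) oo (F - 1))"
    using F0 by (simp add: fps_compose_mult_distrib fps_compose_add_distrib)
  then have "F * (fps_deriv (fps_binomial a) oo (F - 1)) = fps_const a * fps_cpow F a"
    unfolding d using F0 by (simp add: fps_compose_mult_distrib fps_cpow_def)
  then show ?thesis
    using F0 by (simp add: fps_cpow_def fps_compose_deriv mult_ac)
qed

section \<open>Identities from the generating functions\<close>

locale delta_Sheffer =
  fixes \<alpha> \<beta> w :: complex and b :: "nat \<Rightarrow> complex" and A :: "complex fps"
    and P Q :: "nat \<Rightarrow> complex poly"
  assumes w: "w = \<alpha> - \<beta>" and w_nz: "w \<noteq> 0"
    and A0: "fps_nth A 0 = 1" and A_deriv: "fps_deriv A / A = egf b"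
    and P_gf: "egf (\<lambda>n. poly (P n) x) =
          fps_cpow ((1 - fps_const \<beta> * fps_X) / (1 - fps_const \<alpha> * fps_X)) (x / w) * A"
    and Q_def: "poly (Q n) x = Delta w (poly (P (n + 1))) x / of_nat (n + 1)"
begin

abbreviation G :: "complex \<Rightarrow> complex fps" where
  "G x \<equiv> egf (\<lambda>n. poly (P n) x)"

abbreviation H :: "complex \<Rightarrow> complex fps" where
  "H x \<equiv> egf (\<lambda>n. poly (Q n) x)"

abbreviation lin :: "complex \<Rightarrow> complex fps" where
  "lin c \<equiv> 1 - fps_const c * fps_X"

lemma lin_nz: "lin c \<noteq> 0"
proof
  assume "lin c = 0"
  then have "fps_nth (lin c) 0 = 0" by simp
  then show False by simp
qed

lemma base: "lin \<alpha> * (lin \<beta> / lin \<alpha>) = lin \<beta>" "fps_nth (lin \<beta> / lin \<alpha>) 0 = 1"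
proof -
  have "lin \<alpha> * inverse (lin \<alpha>) = 1" by (rule inverse_mult_eq_1') simp
  then show "lin \<alpha> * (lin \<beta> / lin \<alpha>) = lin \<beta>"
    by (simp add: fps_divide_unit mult.left_commute)
  show "fps_nth (lin \<beta> / lin \<alpha>) 0 = 1" by (simp add: fps_divide_unit)
qed

lemma G_shift: "lin \<alpha> * G (x + w) = lin \<beta> * G x"
proof -
  have "(x + w) / w = x / w + 1" using w_nz by (simp add: field_simps)
  then have "G (x + w) = (lin \<beta> / lin \<alpha>) * G x"
    using fps_cpow_add_one[OF base(2), of "x / w"] by (simp add: P_gf mult.assoc)
  then show ?thesis using base(1) by (simp flip: mult.assoc)
qed

lemma P_0: "P 0 = 1"
proof -
  have "poly (P 0) x = 1" for x
    using arg_cong[OF P_gf[of x], of "\<lambda>f. fps_nth f 0"] A0 by (simp add: fps_cpow_nth_0)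
  then show ?thesis by (simp add: fun_eq_iff flip: poly_eq_poly_eq_iff)
qed

lemma Delta_P: "poly (P n) (x + w) - poly (P n) x = w * of_nat n * poly (Q (n - 1)) x"
proof (cases n)
  case (Suc k)
  then show ?thesis using w_nz by (simp add: Q_def Delta_def field_simps del: of_nat_Suc)
qed (simp add: P_0)

text \<open>
  The difference of \<open>G\<close> is \<open>w t H\<close> by definition of \<open>Q\<close>; by the shift rule it is also \<open>w t G\<close>
  divided by \<open>1 - \<alpha>t\<close>.
\<close>
lemma H_G: "lin \<alpha> * H x = G x"
proof -
  have "fps_const w * fps_X * H x = G (x + w) - G x"
    by (simp add: mult.assoc egf_X_mult egf_scale egf_diff egf_eq_iff Delta_P)
  then have "fps_const w * fps_X * (lin \<alpha> * H x) = lin \<alpha> * (G (x + w) - G x)"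
    by (simp add: mult_ac)
  also have "\<dots> = lin \<beta> * G x - lin \<alpha> * G x"
    by (simp only: right_diff_distrib G_shift)
  also have "\<dots> = fps_const w * fps_X * G x"
    by (simp add: w algebra_simps flip: fps_const_sub)
  finally show ?thesis using w_nz by simp
qed

lemma H_G_shift: "lin \<beta> * H x = G (x + w)"
proof -
  have "lin \<alpha> * (lin \<beta> * H x) = lin \<alpha> * G (x + w)"
    by (simp add: G_shift H_G mult.left_commute)
  then show ?thesis using lin_nz by simp
qed

lemma P_eq_Q: "poly (P n) x = poly (Q n) x - of_nat n * \<alpha> * poly (Q (n - 1)) x"
  using H_G[of x] unfolding egf_linear_mult egf_eq_iff by simp

lemma P_shift_eq_Q: "poly (P n) (x + w) = poly (Q n) x - of_nat n * \<beta> * poly (Q (n - 1)) x"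
  using H_G_shift[of x] unfolding egf_linear_mult egf_eq_iff by simp

lemma P_shift_eq_P:
  "poly (P n) (x + w) - of_nat n * \<alpha> * poly (P (n - 1)) (x + w)
    = poly (P n) x - of_nat n * \<beta> * poly (P (n - 1)) x"
  using G_shift[of x] unfolding egf_linear_mult egf_eq_iff by simp

lemma Q_eq_P: "w * poly (Q n) x = \<alpha> * poly (P n) (x + w) - \<beta> * poly (P n) x"
  by (simp only: P_shift_eq_Q) (simp add: w P_eq_Q algebra_simps)

lemma deriv_base: "lin \<alpha> * lin \<alpha> * fps_deriv (lin \<beta> / lin \<alpha>) = fps_const w"
proof -
  define F where "F = lin \<beta> / lin \<alpha>"
  have F: "lin \<alpha> * F = lin \<beta>" using base(1) by (simp add: F_def)
  have "lin \<alpha> * fps_deriv F - fps_const \<alpha> * F = - fps_const \<beta>"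
    using arg_cong[OF F, of fps_deriv] by (simp add: algebra_simps)
  then have "lin \<alpha> * fps_deriv F = fps_const \<alpha> * F - fps_const \<beta>"
    by (simp add: diff_eq_eq)
  then have "lin \<alpha> * lin \<alpha> * fps_deriv F = fps_const \<alpha> * (lin \<alpha> * F) - fps_const \<beta> * lin \<alpha>"
    by (simp only: mult.assoc) (simp only: right_diff_distrib mult_ac)
  also have "\<dots> = fps_const w"
    unfolding F by (simp add: w algebra_simps flip: fps_const_sub)
  finally show ?thesis by (simp only: F_def)
qed

text \<open>
  Logarithmic differentiation of \<open>G = F\<^bsup>x/w\<^esup> A\<close> with \<open>F = (1 - \<beta>t)/(1 - \<alpha>t)\<close>: by
  \<open>deriv_base\<close>, \<open>F'/F = w/((1 - \<alpha>t)(1 - \<beta>t))\<close>, and one factor \<open>1 - \<alpha>t\<close> is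
  absorbed by passing from \<open>G\<close> to \<open>H\<close>.
\<close>
lemma G_deriv: "fps_const x * H x = lin \<beta> * (fps_deriv (G x) - egf b * G x)"
proof -
  define F where "F = lin \<beta> / lin \<alpha>"
  define C where "C = fps_cpow F (x / w)"
  have GC: "G x = C * A" by (simp add: P_gf C_def F_def)
  have FC: "F * fps_deriv C = fps_const (x / w) * fps_deriv F * C"
    using fps_deriv_cpow base(2) by (simp add: C_def F_def)
  have A': "fps_deriv A = egf b * A"
  proof -
    have "inverse A * A = 1" using A0 by (intro inverse_mult_eq_1) simp
    then show ?thesis using A0 by (simp add: fps_divide_unit mult.assoc flip: A_deriv)
  qed
  have "lin \<alpha> * lin \<beta> * fps_deriv C = lin \<alpha> * lin \<alpha> * (F * fps_deriv C)"
    using base(1) by (simp add: F_def mult_ac)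
  also have "\<dots> = fps_const (x / w) * (lin \<alpha> * lin \<alpha> * fps_deriv F) * C"
    by (simp only: FC mult_ac)
  also have "\<dots> = fps_const x * C"
    using w_nz by (simp only: deriv_base F_def) simp
  finally have C': "lin \<alpha> * lin \<beta> * fps_deriv C = fps_const x * C" .
  have "lin \<alpha> * (lin \<beta> * (fps_deriv (G x) - egf b * G x)) = (lin \<alpha> * lin \<beta> * fps_deriv C) * A"
    by (simp add: GC A' algebra_simps)
  also have "\<dots> = lin \<alpha> * (fps_const x * H x)"
    by (simp only: C' mult.left_commute[of "lin \<alpha>"] H_G) (simp add: GC mult.assoc)
  finally show ?thesis using lin_nz by simp
qed

text \<open>
  Coefficient comparison in \<open>G_deriv\<close>. The two convolution sums with \<open>b\<close> come from the terms
  \<open>1\<close> and \<open>-\<beta>t\<close> of the factor \<open>1 - \<beta>t\<close>; absorbing \<open>n\<close> into the binomial coefficient of the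
  second one aligns it with the first, and the vanishing of \<open>b\<close> from \<open>d - 1\<close> on cuts the sum
  off at \<open>d - 1\<close>.
\<close>
lemma x_mult_Q:
  assumes b: "\<forall>k. k + 1 \<ge> d \<longrightarrow> b k = 0" and d: "d \<ge> 1"
  shows "x * poly (Q n) x
     = poly (P (n + 1)) x - (b 0 + \<beta> * of_nat n) * poly (P n) x
       + (\<Sum>i=1..d-1. of_nat (n choose i) * (\<beta> * of_nat i * b (i - 1) - b i)
            * poly (P (n - i)) x)"
proof -
  define p where "p i = poly (P i) x" for i
  define S where "S n = (\<Sum>i\<le>n. of_nat (n choose i) * b i * p (n - i))" for n
  have "x * poly (Q n) x = (p (Suc n) - S n) - of_nat n * \<beta> * (p (Suc (n - 1)) - S (n - 1))"
    using G_deriv[of x]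
    unfolding egf_deriv egf_mult egf_diff egf_linear_mult egf_scale egf_eq_iff S_def p_def by blast
  also have "\<dots> = p (Suc n) - \<beta> * of_nat n * p n - S n + \<beta> * (of_nat n * S (n - 1))"
    by (cases n) (simp_all add: algebra_simps)
  also have "of_nat n * S (n - 1)
      = (\<Sum>i=1..n. of_nat (n choose i) * of_nat i * b (i - 1) * p (n - i))"
  proof (cases n)
    case (Suc k)
    have "of_nat (Suc k) * of_nat (k choose i)
        = (of_nat (Suc k choose Suc i) * of_nat (Suc i) :: complex)" for i
      by (simp only: Suc_times_binomial_eq flip: of_nat_mult)
    then have "of_nat (Suc k) * S k
        = (\<Sum>i\<le>k. of_nat (Suc k choose Suc i) * of_nat (Suc i) * b i * p (k - i))"
      unfolding S_def sum_distrib_left by (simp only: mult.assoc[symmetric])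
    also have "\<dots> = (\<Sum>i=1..Suc k. of_nat (Suc k choose i) * of_nat i * b (i - 1) * p (Suc k - i))"
      by (simp only: One_nat_def sum.atLeast_Suc_atMost_Suc_shift atLeast0AtMost o_def
          diff_Suc_Suc diff_Suc_1 diff_zero)
    finally show ?thesis using Suc by simp
  qed simp
  also have "S n = b 0 * p n + (\<Sum>i=1..n. of_nat (n choose i) * b i * p (n - i))"
    by (simp add: S_def sum.atLeast_Suc_atMost flip: atLeast0AtMost)
  also have "p (Suc n) - \<beta> * of_nat n * p n
        - (b 0 * p n + (\<Sum>i=1..n. of_nat (n choose i) * b i * p (n - i)))
        + \<beta> * (\<Sum>i=1..n. of_nat (n choose i) * of_nat i * b (i - 1) * p (n - i))
      = p (Suc n) - (b 0 + \<beta> * of_nat n) * p n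
        + (\<Sum>i=1..n. of_nat (n choose i) * (\<beta> * of_nat i * b (i - 1) - b i) * p (n - i))"
    by (simp add: algebra_simps sum_subtractf sum_distrib_left)
  also have "(\<Sum>i=1..n. of_nat (n choose i) * (\<beta> * of_nat i * b (i - 1) - b i) * p (n - i))
      = (\<Sum>i=1..d-1. of_nat (n choose i) * (\<beta> * of_nat i * b (i - 1) - b i) * p (n - i))"
  proof (rule sum.mono_neutral_cong)
    fix i assume i: "i \<in> {1..n} - {1..d-1}"
    then have "b i = 0" "b (i - 1) = 0" using b d by auto
    then show "of_nat (n choose i) * (\<beta> * of_nat i * b (i - 1) - b i) * p (n - i) = 0" by simp
  qed auto
  finally show ?thesis by (simp add: p_def)
qed

end

section \<open>The constant attached to the two recurrences\<close>

lemma monic_seq_coeff: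
  assumes "monic_seq P"
  shows "coeff (P n) n = 1" and "k < m \<Longrightarrow> coeff (P k) m = 0"
proof -
  have P: "degree (P i) = i \<and> lead_coeff (P i) = 1" for i
    using assms unfolding monic_seq_def by blast
  show "coeff (P n) n = 1" using P[of n] by metis
  show "coeff (P k) m = 0" if "k < m" using that P[of k] by (simp add: coeff_eq_0)
qed

lemma ext0_pred: "ext0 P (int n - 1) = (if n = 0 then 0 else P (n - 1))"
  by (cases n) (simp_all add: ext0_def)

lemma recurrence_subleading:
  assumes P: "monic_seq P" and rec: "recurrence_coeffs d P be ga" and n: "n \<ge> 1"
  shows "coeff (P (n + 1)) n = coeff (P n) (n - 1) - be n"
proof -
  have "coeff (ext0 P (int n - 1 - int \<nu>)) n = 0" for \<nu>
    using n by (auto simp: ext0_def intro!: monic_seq_coeff(2)[OF P])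
  then have "coeff (\<Sum>\<nu><d. smult (ga (d - 1 - \<nu>) (n - \<nu>)) (ext0 P (int n - 1 - int \<nu>))) n = 0"
    by (simp add: coeff_sum)
  then have "coeff (P (n + 1)) n = coeff ([:- be n, 1:] * P n) n"
    using rec[unfolded recurrence_coeffs_def, rule_format, of n] by (simp only: coeff_diff diff_zero)
  also have "\<dots> = coeff (P n) (n - 1) - be n"
    using n monic_seq_coeff(1)[OF P, of n] by (cases n) simp_all
  finally show ?thesis .
qed

text \<open>
  A functional that kills all \<open>P\<^sub>n\<close> but the first takes on \<open>Q\<^sub>n\<close> the value
  \<open>\<lambda>\<^sub>n \<cdots> \<lambda>\<^sub>1 L(Q\<^sub>0)\<close>. Dividing the recurrence of \<open>Q\<close>, evaluated under \<open>L\<close>, by \<open>L(Q\<^sub>m)\<close> therefore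
  produces exactly the denominators \<open>\<lambda>\<^sub>m \<cdots> \<lambda>\<^bsub>m-j\<^esub>\<close> on the left-hand side.
\<close>
lemma recurrence_constant_as_ratio:
  fixes L :: "complex poly \<Rightarrow> complex"
  assumes P: "monic_seq P" and Q: "monic_seq Q"
    and recP: "recurrence_coeffs d P be ga" and recQ: "recurrence_coeffs d Q xi eta"
    and conn: "\<And>n. n \<ge> 1 \<Longrightarrow> P n = Q n - smult (lam n) (Q (n - 1))"
    and lam: "\<And>n. n \<ge> 1 \<Longrightarrow> lam n \<noteq> 0"
    and L: "Vector_Spaces.linear smult (*) L"
    and L0: "L (Q 0) \<noteq> 0" and LP: "\<And>n. n \<ge> 1 \<Longrightarrow> L (P n) = 0"
    and d: "d \<ge> 1" and m: "m \<ge> d"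
  shows "be m + lam m + (\<Sum>j=0..d-1. eta (d - 1 - j) (m - j) / (\<Prod>i=0..j. lam (m - i)))
    = L ([:0, 1:] * Q m) / L (Q m)"
proof -
  interpret L: Vector_Spaces.linear smult "(*)" L by (fact L)
  have LQ: "L (Q n) = lam n * L (Q (n - 1))" if "n \<ge> 1" for n
    using LP[OF that] conn[OF that] by (simp add: L.diff L.scale)
  have nz: "L (Q n) \<noteq> 0" for n
  proof (induction n)
    case (Suc n)
    then show ?case using LQ[of "Suc n"] lam[of "Suc n"] by simp
  qed (rule L0)
  have prod: "L (Q m) = (\<Prod>i=0..j. lam (m - i)) * L (Q (m - 1 - j))" if "j < m" for j
    using that
  proof (induction j)
    case 0
    then have "L (Q m) = lam m * L (Q (m - 1))" by (intro LQ) simp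
    then show ?case by simp
  next
    case (Suc j)
    then have "L (Q m) = (\<Prod>i=0..j. lam (m - i)) * L (Q (m - Suc j))" by simp
    also have "L (Q (m - Suc j)) = lam (m - Suc j) * L (Q (m - 1 - Suc j))"
      using LQ[of "m - Suc j"] Suc.prems by (simp only: diff_commute[of m 1])
    finally show ?case by (simp only: prod.atLeast0_atMost_Suc mult.assoc)
  qed
  have ratio: "L (Q (m - 1 - j)) / L (Q m) = 1 / (\<Prod>i=0..j. lam (m - i))" if "j < m" for j
    using prod[OF that] nz[of "m - 1 - j"] nz[of m] by (simp add: field_simps)
  \<comment> \<open>Both recurrences are read off at the second highest coefficient; the connection formula
    compares those coefficients, so \<open>be\<close> can be traded for \<open>xi\<close>.\<close>
  have sub: "be m + lam m = xi m + lam (m + 1)"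
  proof -
    have c: "coeff (P n) (n - 1) = coeff (Q n) (n - 1) - lam n" if "n \<ge> 1" for n
      using conn[OF that] monic_seq_coeff(1)[OF Q, of "n - 1"] by simp
    have "coeff (P m) (m - 1) = coeff (Q m) (m - 1) - lam m"
      "coeff (P (m + 1)) m = coeff (Q (m + 1)) m - lam (m + 1)"
      using c[of m] c[of "m + 1"] d m by simp_all
    moreover have "coeff (P (m + 1)) m = coeff (P m) (m - 1) - be m"
      "coeff (Q (m + 1)) m = coeff (Q m) (m - 1) - xi m"
      using recurrence_subleading[OF P recP, of m] recurrence_subleading[OF Q recQ, of m] d m by simp_all
    ultimately show ?thesis by algebra
  qed
  have "ext0 Q (int m - 1 - int \<nu>) = Q (m - 1 - \<nu>)" if "\<nu> < d" for \<nu>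
    using that m by (auto simp: ext0_def nat_diff_distrib intro!: arg_cong[of _ _ Q])
  then have "Q (m + 1) = [:- xi m, 1:] * Q m
      - (\<Sum>\<nu><d. smult (eta (d - 1 - \<nu>) (m - \<nu>)) (Q (m - 1 - \<nu>)))"
    using recQ by (simp add: recurrence_coeffs_def)
  also have "[:- xi m, 1:] * Q m = [:0, 1:] * Q m - smult (xi m) (Q m)" by simp
  finally have "L (Q (m + 1)) = L ([:0, 1:] * Q m) - xi m * L (Q m)
      - (\<Sum>\<nu><d. eta (d - 1 - \<nu>) (m - \<nu>) * L (Q (m - 1 - \<nu>)))"
    by (simp only: L.diff L.scale L.sum)
  moreover have "L (Q (m + 1)) = lam (m + 1) * L (Q m)"
    using LQ[of "m + 1"] by simp
  ultimately have "L ([:0, 1:] * Q m) = (xi m + lam (m + 1)) * L (Q m)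
      + (\<Sum>\<nu><d. eta (d - 1 - \<nu>) (m - \<nu>) * L (Q (m - 1 - \<nu>)))"
    by (simp add: algebra_simps)
  then have "L ([:0, 1:] * Q m) / L (Q m) = xi m + lam (m + 1)
      + (\<Sum>\<nu><d. eta (d - 1 - \<nu>) (m - \<nu>) * (L (Q (m - 1 - \<nu>)) / L (Q m)))"
    using nz[of m] by (simp add: add_divide_distrib sum_divide_distrib)
  also have "(\<Sum>\<nu><d. eta (d - 1 - \<nu>) (m - \<nu>) * (L (Q (m - 1 - \<nu>)) / L (Q m)))
      = (\<Sum>j=0..d-1. eta (d - 1 - j) (m - j) / (\<Prod>i=0..j. lam (m - i)))"
    using d m ratio by (intro sum.cong) auto
  finally show ?thesis using sub by simp
qed

section \<open>The difference relations between the two sequences\<close>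

theorem proposition3p4:
  fixes d :: nat and \<alpha> \<beta> w :: complex and b :: "nat \<Rightarrow> complex"
    and A :: "complex fps" and P Q :: "nat \<Rightarrow> complex poly"
    and be xi :: "nat \<Rightarrow> complex" and ga eta :: "nat \<Rightarrow> nat \<Rightarrow> complex"
    and lam :: "nat \<Rightarrow> complex"
  assumes "d \<ge> 1"
    and "w = \<alpha> - \<beta>" and "w \<noteq> 0"
    and "\<forall>k. k + 1 \<ge> d \<longrightarrow> b k = 0"
    and "fps_nth A 0 = 1"
    and "fps_deriv A / A = Abs_fps (\<lambda>k. b k / fact k)"
    and "\<forall>x. Abs_fps (\<lambda>n. poly (P n) x / fact n) =
          fps_cpow ((1 - fps_const \<beta> * fps_X) / (1 - fps_const \<alpha> * fps_X)) (x / w) * A"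
    and "\<forall>n x. poly (Q n) x = Delta w (poly (P (n + 1))) x / of_nat (n + 1)"
    and "d_orthogonal d P" and "d_orthogonal d Q"
    and "recurrence_coeffs d P be ga" and "recurrence_coeffs d Q xi eta"
    and "\<forall>m. lam m = of_nat m * \<alpha>"
  shows "(\<forall>n x. poly (P n) (x + w) = poly (Q n) x - of_nat n * \<beta> * poly (ext0 Q (int n - 1)) x)
    \<and> (\<forall>n x. poly (P n) x - \<beta> * of_nat n * poly (ext0 P (int n - 1)) x
          = poly (P n) (x + w) - \<alpha> * of_nat n * poly (ext0 P (int n - 1)) (x + w))
    \<and> (\<forall>n x. w * poly (Q n) x = \<alpha> * poly (P n) (x + w) - \<beta> * poly (P n) x)
    \<and> (\<forall>n x. Delta w (\<lambda>y. poly (P (n + 1)) y * poly (P n) y) x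
          = of_nat (n + 1) * poly (P n) (x + w) * poly (Q n) x
            + of_nat n * poly (P (n + 1)) x * poly (ext0 Q (int n - 1)) x)
    \<and> (\<forall>n x. Delta w (\<lambda>y. poly (P (n + 1)) y * poly (P n) y) x
          = of_nat (n + 1) * (poly (Q n) x)\<^sup>2
            + of_nat n * poly (P (n + 1)) x * poly (ext0 Q (int n - 1)) x
            - of_nat n * of_nat (n + 1) * \<beta> * poly (Q n) x * poly (ext0 Q (int n - 1)) x)
    \<and> (\<exists>c. (\<forall>m\<ge>d. be m = c - lam m
              - (\<Sum>j=0..d-1. eta (d - 1 - j) (m - j) / (\<Prod>i=0..j. lam (m - i))))
          \<and> (\<forall>n x. (x - c) * poly (Q n) x
              = poly (P (n + 1)) x - (c + b 0 + \<beta> * of_nat n) * poly (P n) x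
                + (\<Sum>i=1..d-1. of_nat (n choose i) * (\<beta> * of_nat i * b (i - 1) - b i)
                      * poly (ext0 P (int n - int i)) x)))"
proof -
  have A': "fps_deriv A / A = egf b" using assms(6) by (simp add: egf_def)
  have gf: "egf (\<lambda>n. poly (P n) x) =
      fps_cpow ((1 - fps_const \<beta> * fps_X) / (1 - fps_const \<alpha> * fps_X)) (x / w) * A" for x
    using assms(7) by (simp add: egf_def)
  interpret delta_Sheffer \<alpha> \<beta> w b A P Q
    by unfold_locales (use assms(2,3,5,8) A' gf in simp_all)
  have shift: "poly (P n) (x + w) = poly (Q n) x - of_nat n * \<beta> * poly (ext0 Q (int n - 1)) x"
    for n x by (simp add: P_shift_eq_Q ext0_pred)
  have product: "Delta w (\<lambda>y. poly (P (n + 1)) y * poly (P n) y) x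
      = of_nat (n + 1) * poly (P n) (x + w) * poly (Q n) x
        + of_nat n * poly (P (n + 1)) x * poly (ext0 Q (int n - 1)) x" for n x
  proof -
    have 1: "poly (P (n + 1)) (x + w) = poly (P (n + 1)) x + w * of_nat (n + 1) * poly (Q n) x"
      using Delta_P[of "n + 1" x] by (simp add: algebra_simps)
    have 2: "poly (P n) (x + w) = poly (P n) x + w * (of_nat n * poly (ext0 Q (int n - 1)) x)"
      using Delta_P[of n x] by (simp add: ext0_pred algebra_simps)
    have "poly (P (n + 1)) (x + w) * poly (P n) (x + w) - poly (P (n + 1)) x * poly (P n) x
      = w * (of_nat (n + 1) * poly (P n) (x + w) * poly (Q n) x
        + of_nat n * poly (P (n + 1)) x * poly (ext0 Q (int n - 1)) x)"
      unfolding 1 2 by algebra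
    then show ?thesis using w_nz by (simp add: Delta_def)
  qed
  have P: "monic_seq P" and Q: "monic_seq Q"
    using assms(9,10) by (auto simp: d_orthogonal_def)
  obtain L where L: "Vector_Spaces.linear smult (*) L"
    and L_mono: "\<And>m n. n \<ge> m * d + 1 \<Longrightarrow> L (monom 1 m * P n) = 0"
    and L_nz: "\<And>m. L (monom 1 m * P (m * d)) \<noteq> 0"
    using assms(1,9) unfolding d_orthogonal_def by (metis add.right_neutral less_eq_Suc_le One_nat_def)
  interpret L: Vector_Spaces.linear smult "(*)" L by (fact L)
  have LP: "L (P n) = 0" if "n \<ge> 1" for n
    using L_mono[of 0 n] that by simp
  have X: "monom 1 1 = ([:0, 1:] :: complex poly)" by (simp add: monom_altdef)
  have conn: "P n = Q n - smult (of_nat n * \<alpha>) (Q (n - 1))" for n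
    by (simp add: P_eq_Q fun_eq_iff flip: poly_eq_poly_eq_iff)
  \<comment> \<open>The expansion of \<open>x Q\<^sub>n\<close> reaches down only to \<open>P\<^bsub>n-d+1\<^esub>\<close>, so \<open>P\<^sub>0\<close>, the only
    member on which \<open>L\<close> is nonzero, is absent.\<close>
  have LxQ: "L ([:0, 1:] * Q n) = 0" if "n \<ge> d" for n
  proof -
    have "[:0, 1:] * Q n = P (n + 1) - smult (b 0 + \<beta> * of_nat n) (P n)
       + (\<Sum>i=1..d-1. smult (of_nat (n choose i) * (\<beta> * of_nat i * b (i - 1) - b i)) (P (n - i)))"
      using x_mult_Q[OF assms(4,1)]
      by (simp add: fun_eq_iff poly_sum flip: poly_eq_poly_eq_iff)
    moreover have "L (P (n - i)) = 0" if "i \<in> {1..d-1}" for i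
      using that \<open>n \<ge> d\<close> assms(1) by (intro LP) auto
    ultimately show ?thesis
      using that assms(1) by (simp only: L.diff L.add L.scale L.sum LP) (simp add: LP)
  qed
  \<comment> \<open>If \<open>\<alpha> = 0\<close>, then \<open>P = Q\<close> and \<open>LxQ\<close> contradicts the regularity \<open>L (x P\<^sub>d) \<noteq> 0\<close>.\<close>
  have "\<alpha> \<noteq> 0"
  proof
    assume "\<alpha> = 0"
    then have "P d = Q d" using conn[of d] by simp
    then show False using LxQ[of d] L_nz[of 1] X by simp
  qed
  then have lam: "lam n \<noteq> 0" if "n \<ge> 1" for n using assms(13) that by simp
  have L0: "L (Q 0) \<noteq> 0" using L_nz[of 0] conn[of 0] by simp
  \<comment> \<open>The ratio is 0 by \<open>LxQ\<close>, so the constant of the statement is 0.\<close>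
  have c0: "be m = 0 - lam m - (\<Sum>j=0..d-1. eta (d - 1 - j) (m - j) / (\<Prod>i=0..j. lam (m - i)))"
    if "m \<ge> d" for m
  proof -
    have "be m + lam m + (\<Sum>j=0..d-1. eta (d - 1 - j) (m - j) / (\<Prod>i=0..j. lam (m - i)))
        = L ([:0, 1:] * Q m) / L (Q m)"
      using assms(13) conn
      by (intro recurrence_constant_as_ratio[OF P Q assms(11,12) _ lam L L0 LP assms(1) that]) auto
    then show ?thesis using LxQ[OF that] by (simp add: algebra_simps eq_neg_iff_add_eq_0)
  qed
  have expansion: "(x - 0) * poly (Q n) x
      = poly (P (n + 1)) x - (0 + b 0 + \<beta> * of_nat n) * poly (P n) x
        + (\<Sum>i=1..d-1. of_nat (n choose i) * (\<beta> * of_nat i * b (i - 1) - b i)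
              * poly (ext0 P (int n - int i)) x)" for n x
  proof -
    have ext: "of_nat (n choose i) * (\<beta> * of_nat i * b (i - 1) - b i) * poly (ext0 P (int n - int i)) x
        = of_nat (n choose i) * (\<beta> * of_nat i * b (i - 1) - b i) * poly (P (n - i)) x" for i
      by (cases "i \<le> n") (simp_all add: ext0_def nat_diff_distrib)
    show ?thesis unfolding ext using x_mult_Q[OF assms(4,1), of x n] by simp
  qed
  have backward: "poly (P n) x - \<beta> * of_nat n * poly (ext0 P (int n - 1)) x
      = poly (P n) (x + w) - \<alpha> * of_nat n * poly (ext0 P (int n - 1)) (x + w)" for n x
    using P_shift_eq_P[of n x] by (simp add: ext0_pred P_0 mult.commute)
  have square: "Delta w (\<lambda>y. poly (P (n + 1)) y * poly (P n) y) x
      = of_nat (n + 1) * (poly (Q n) x)\<^sup>2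
        + of_nat n * poly (P (n + 1)) x * poly (ext0 Q (int n - 1)) x
        - of_nat n * of_nat (n + 1) * \<beta> * poly (Q n) x * poly (ext0 Q (int n - 1)) x" for n x
    unfolding product shift by algebra
  show ?thesis
    by (intro conjI allI impI exI[of _ 0] shift backward Q_eq_P product square c0 expansion)
qed

end
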